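(* There are $\mathfrak{c}$ many pairwise non-isomorphic ideals $\mathcal{I}$ on $\omega$ with the following property: for every $A\subseteq\omega$ with $A\notin\mathcal{I}$, if $\mathcal{I}|A\cong\mathcal{I}$, then this is witnessed by the increasing enumeration of $A$.
   Context: $\omega=\{0,1,2,\ldots\}$. An ideal on $\omega$ is a family $\mathcal{I}$ of subsets of $\omega$ with $\emptyset\in\mathcal{I}$, $\omega\notin\mathcal{I}$, closed under finite unions and subsets; all ideals considered are assumed to contain all finite subsets of $\omega$. Ideals $\mathcal{I},\mathcal{J}$ on $\omega$ are isomorphic if there is a bijection $\phi\colon\omega\to\omega$ such that for all $A\subseteq\omega$, $A\in\mathcal{I}\iff\phi^{-1}[A]\in\mathcal{J}$. For $A\notin\mathcal{I}$, $\mathcal{I}|A=\{A\cap B:\ B\in\mathcal{I}\}$ is the restriction of $\mathcal{I}$ to $A$. $\mathcal{I}|A\cong\mathcal{I}$ means that there is a bijection $\phi\colon\omega\to A$ such that for all $B\subseteq A$, $B\in\mathcal{I}|A\iff\phi^{-1}[B]\in\mathcal{I}$; such a $\phi$ is said to witness that $\mathcal{I}|A\cong\mathcal{I}$. The increasing enumeration of an infinite set $A=\{a_0<a_1<\ldots\}$ is the map $n\mapsto a_n$. $\mathfrak{c}$ is the cardinality of the continuum. *)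

theory Defs
  imports Complex_Main "HOL-Library.Infinite_Set" "HOL-Library.Equipollence"
begin

(* The last condition is the standing assumption that ideals contain all finite sets. *)
definition ideal_on_omega :: "nat set set \<Rightarrow> bool" where
  "ideal_on_omega \<I> \<longleftrightarrow>
     {} \<in> \<I> \<and> UNIV \<notin> \<I> \<and>
     (\<forall>A\<in>\<I>. \<forall>B\<in>\<I>. A \<union> B \<in> \<I>) \<and>
     (\<forall>A\<in>\<I>. \<forall>B. B \<subseteq> A \<longrightarrow> B \<in> \<I>) \<and>
     (\<forall>A. finite A \<longrightarrow> A \<in> \<I>)"

definition ideal_isomorphic :: "nat set set \<Rightarrow> nat set set \<Rightarrow> bool" where
  "ideal_isomorphic \<I> \<J> \<longleftrightarrow>
     (\<exists>\<phi>::nat \<Rightarrow> nat. bij \<phi> \<and> (\<forall>A. A \<in> \<I> \<longleftrightarrow> \<phi> -` A \<in> \<J>))"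

definition ideal_restrict :: "nat set set \<Rightarrow> nat set \<Rightarrow> nat set set" where
  "ideal_restrict \<I> A = {A \<inter> B | B. B \<in> \<I>}"

definition witnesses_restrict_iso :: "nat set set \<Rightarrow> nat set \<Rightarrow> (nat \<Rightarrow> nat) \<Rightarrow> bool" where
  "witnesses_restrict_iso \<I> A \<phi> \<longleftrightarrow>
     bij_betw \<phi> UNIV A \<and>
     (\<forall>B. B \<subseteq> A \<longrightarrow> (B \<in> ideal_restrict \<I> A \<longleftrightarrow> \<phi> -` B \<in> \<I>))"

definition restrict_isomorphic :: "nat set set \<Rightarrow> nat set \<Rightarrow> bool" where
  "restrict_isomorphic \<I> A \<longleftrightarrow> (\<exists>\<phi>. witnesses_restrict_iso \<I> A \<phi>)"

end

theory Submission
  imports Defs "HOL-Analysis.Infinite_Sum" "HOL-Analysis.Summation_Tests"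
    "HOL-Analysis.Abstract_Topology_2"
begin

text \<open>
  For \<open>0 < a < 1\<close> take the summable ideal of all \<open>S\<close> with \<open>\<Sum>n\<in>S. (n + 1) powr - a < \<infinity>\<close>. If one summable
  ideal is carried into another by an injection \<open>\<phi>\<close>, then the two weights are comparable along \<open>\<phi>\<close>
  outside a set of the ideal. Such a set has only \<open>O(n powr a) = o(n)\<close> elements below \<open>n\<close>, so \<open>\<phi>\<close>
  essentially preserves the counting functions of the weights. This recovers the exponent, and it
  forces any \<open>A\<close> whose restriction is isomorphic to the ideal to have positive lower density; then
  the increasing enumeration of \<open>A\<close> distorts the weights only by a bounded factor.
\<close>

section \<open>Comparing two weights through their summable sets\<close>

text \<open>Nonsummability of a nonnegative weight makes its finite sums unbounded. A finite set of
  least cardinality with sum at least 1 falls below 1 when any point is removed, and that point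
  weighs at most 1.\<close>

lemma finite_subset_sum_between:
  fixes f :: "nat \<Rightarrow> real"
  assumes f: "\<And>n. 0 \<le> f n" "\<And>n. f n \<le> 1" and W: "\<not> f summable_on W"
  obtains F where "finite F" "F \<subseteq> W" "1 \<le> sum f F" "sum f F \<le> 2"
proof -
  have "\<exists>X. finite X \<and> X \<subseteq> W \<and> 1 \<le> sum f X"
  proof (rule ccontr)
    assume "\<not> ?thesis"
    then have "\<And>X. X \<subseteq> W \<Longrightarrow> finite X \<Longrightarrow> sum f X \<le> 1" by (meson linear)
    then have "bdd_above (sum f ` {X. X \<subseteq> W \<and> finite X})"
      by (intro bdd_aboveI[where M = 1]) auto
    then have "f summable_on W"
      by (rule nonneg_bdd_above_summable_on[rotated]) (rule f)
    with W show False by simp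
  qed
  then obtain X where X: "finite X" "X \<subseteq> W" "1 \<le> sum f X" by blast
  define P where "P k \<longleftrightarrow> (\<exists>Y. finite Y \<and> Y \<subseteq> W \<and> 1 \<le> sum f Y \<and> card Y = k)" for k
  have "P (card X)" using X P_def by blast
  then have "P (Least P)" by (rule LeastI)
  then obtain Y where Y: "finite Y" "Y \<subseteq> W" "1 \<le> sum f Y" "card Y = Least P"
    unfolding P_def by blast
  then obtain y where y: "y \<in> Y" by fastforce
  have "sum f (Y - {y}) < 1"
  proof (rule ccontr)
    assume "\<not> ?thesis"
    then have "P (card (Y - {y}))"
      unfolding P_def using Y by (intro exI[of _ "Y - {y}"]) auto
    then have "Least P \<le> card (Y - {y})" by (rule Least_le)
    with Y y show False using card_Diff1_less[of Y y] by simp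
  qed
  moreover have "sum f Y = f y + sum f (Y - {y})"
    using Y y by (simp add: sum.remove)
  ultimately have "sum f Y \<le> 2" using f(2)[of y] by linarith
  with Y that show ?thesis by blast
qed

text \<open>The blocks may overlap, so nonnegativity gives subadditivity only.\<close>

lemma sum_UN_lessThan_le:
  fixes h :: "'a \<Rightarrow> real"
  assumes "\<And>x. 0 \<le> h x" "\<And>k. finite (F k)"
  shows "sum h (\<Union>k<(N::nat). F k) \<le> (\<Sum>k<N. sum h (F k))"
proof (induction N)
  case (Suc N)
  have "sum h (\<Union>k<Suc N. F k) = sum h ((\<Union>k<N. F k) \<union> F N)"
    by (simp add: lessThan_Suc Un_commute)
  also have "\<dots> \<le> sum h (\<Union>k<N. F k) + sum h (F N)"
    using assms by (subst sum_Un) (auto intro: sum_nonneg)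
  finally show ?case using Suc by simp
qed simp

text \<open>A gliding hump argument: if every constant failed, each \<open>2 ^ k\<close> would
  provide a finite block of \<open>f\<close>-mass at least 1 whose \<open>h\<close>-mass is at most
  a constant times \<open>2 ^ -k\<close>. The union of the blocks would be \<open>h\<close>-summable
  but not \<open>f\<close>-summable.\<close>

lemma summable_inclusion_imp_comparable:
  fixes f h :: "nat \<Rightarrow> real"
  assumes f: "\<And>n. 0 \<le> f n" "\<And>n. f n \<le> 1" and h: "\<And>n. 0 \<le> h n"
    and incl: "\<And>S. h summable_on S \<Longrightarrow> f summable_on S"
  obtains C where "C > 0" "f summable_on {n. f n > C * h n}"
proof (rule ccontr)
  assume "\<not> thesis"
  with that have neg: "\<And>C. C > 0 \<Longrightarrow> \<not> f summable_on {n. f n > C * h n}" by blast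
  \<comment> \<open>The condition \<open>k \<le> n\<close> moves the blocks off to infinity, so that
    some block misses any given finite set. It discards only finitely many points and thus preserves
    nonsummability.\<close>
  have "\<exists>F. finite F \<and> F \<subseteq> {n. k \<le> n \<and> f n > 2 ^ k * h n} \<and> 1 \<le> sum f F \<and> sum f F \<le> 2" for k
  proof -
    let ?W = "{n. f n > 2 ^ k * h n}" and ?V = "{n. k \<le> n \<and> f n > 2 ^ k * h n}"
    have "\<not> f summable_on ?V"
    proof
      assume "f summable_on ?V"
      then have "f summable_on (?V \<union> (?W \<inter> {..<k}))"
        by (intro summable_on_Un_disjoint) auto
      moreover have "?V \<union> (?W \<inter> {..<k}) = ?W" by auto
      ultimately show False using neg[of "2 ^ k"] by simp
    qed
    then obtain F where "finite F" "F \<subseteq> ?V" "1 \<le> sum f F" "sum f F \<le> 2"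
      by (rule finite_subset_sum_between[OF f])
    then show ?thesis by blast
  qed
  then obtain F where F: "\<And>k. finite (F k)" "\<And>k. F k \<subseteq> {n. k \<le> n \<and> f n > 2 ^ k * h n}"
    "\<And>k. 1 \<le> sum f (F k)" "\<And>k. sum f (F k) \<le> 2" by metis
  have hF: "sum h (F k) \<le> 2 * (1/2) ^ k" for k
  proof -
    have "2 ^ k * sum h (F k) = (\<Sum>n\<in>F k. 2 ^ k * h n)" by (simp add: sum_distrib_left)
    also have "\<dots> \<le> sum f (F k)" using F(2)[of k] by (intro sum_mono) force
    also have "\<dots> \<le> 2" by (rule F)
    finally show ?thesis by (simp add: field_simps)
  qed
  define U where "U = (\<Union>k. F k)"
  have "sum h X \<le> 4" if X: "X \<subseteq> U" "finite X" for X
  proof -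
    from X have "\<forall>x\<in>X. \<exists>k. x \<in> F k" by (auto simp: U_def)
    then obtain g where g: "\<forall>x\<in>X. x \<in> F (g x)" by metis
    obtain N where N: "\<forall>k\<in>g ` X. k < N"
      using X(2) by (metis finite_imageI finite_nat_set_iff_bounded)
    have "sum h X \<le> sum h (\<Union>k<N. F k)"
      using g N h F(1) by (intro sum_mono2) auto
    also have "\<dots> \<le> (\<Sum>k<N. sum h (F k))"
      using h F(1) by (rule sum_UN_lessThan_le)
    also have "\<dots> \<le> (\<Sum>k<N. 2 * (1/2) ^ k)"
      using hF by (intro sum_mono)
    also have "\<dots> = 2 * (\<Sum>k<N. (1/2) ^ k)" by (simp add: sum_distrib_left)
    also have "\<dots> \<le> 4" by (simp add: sum_gp_strict)
    finally show ?thesis .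
  qed
  then have "bdd_above (sum h ` {X. X \<subseteq> U \<and> finite X})"
    by (intro bdd_aboveI[where M = 4]) auto
  then have "h summable_on U"
    by (rule nonneg_bdd_above_summable_on[rotated]) (rule h)
  then have fU: "f summable_on U" by (rule incl)
  \<comment> \<open>The finite set \<open>X\<close> exhausts the \<open>f\<close>-sum over
    \<open>U\<close> up to less than 1; a block lying beyond \<open>X\<close> then adds at least 1
    and overshoots the total.\<close>
  obtain X where X: "finite X" "X \<subseteq> U" "infsum f U < sum f X + 1"
  proof -
    have "bdd_above (sum f ` {X. X \<subseteq> U \<and> finite X})"
      using finite_sum_le_infsum[OF fU] f(1) by (intro bdd_aboveI[where M = "infsum f U"]) auto
    then have "infsum f U = (SUP X\<in>{X. finite X \<and> X \<subseteq> U}. sum f X)"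
      by (rule nonneg_bdd_above_infsum[rotated]) (rule f)
    then have "infsum f U - 1 < (SUP X\<in>{X. finite X \<and> X \<subseteq> U}. sum f X)" by simp
    then obtain X where "X \<subseteq> U" "finite X" "infsum f U - 1 < sum f X"
      using less_cSupD[of "sum f ` {X. finite X \<and> X \<subseteq> U}"] by blast
    with that show ?thesis by force
  qed
  obtain k where k: "\<forall>x\<in>X. x < k"
    using X(1) by (metis finite_nat_set_iff_bounded)
  have disj: "X \<inter> F k = {}" using k F(2)[of k] by fastforce
  have "sum f X + 1 \<le> sum f (X \<union> F k)"
    using X F disj by (simp add: sum.union_disjoint)
  also have "\<dots> \<le> infsum f U"
    using X F f fU by (intro finite_sum_le_infsum) (auto simp: U_def)
  finally show False using X by simp
qed

section \<open>Power weights and their summable ideals\<close>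

text \<open>Since \<open>0 powr - a\<close> is 0, the shift by one is what keeps the weight positive
  and decreasing from the index 0 on.\<close>

definition power_weight :: "real \<Rightarrow> nat \<Rightarrow> real" where
  "power_weight a n = real (n + 1) powr - a"

definition power_ideal :: "real \<Rightarrow> nat set set" where
  "power_ideal a = {S. power_weight a summable_on S}"

lemma power_weight_pos: "0 < power_weight a n"
  by (simp add: power_weight_def)

lemma power_weight_nonneg: "0 \<le> power_weight a n"
  by (simp add: power_weight_def)

lemma power_weight_antimono: "0 \<le> a \<Longrightarrow> m \<le> n \<Longrightarrow> power_weight a n \<le> power_weight a m"
  by (simp add: power_weight_def powr_mono2')

lemma power_weight_le_1: "0 \<le> a \<Longrightarrow> power_weight a n \<le> 1"
  using power_weight_antimono[of a 0 n] by (simp add: power_weight_def)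

lemma ideal_on_omega_power_ideal:
  assumes "0 < a" "a < 1"
  shows "ideal_on_omega (power_ideal a)"
proof -
  have "\<not> summable (power_weight a)"
  proof
    assume "summable (power_weight a)"
    then have "summable (\<lambda>n. real (Suc n) powr - a)"
      by (simp add: power_weight_def[abs_def])
    then have "summable (\<lambda>n. real n powr - a)"
      by (subst (asm) summable_Suc_iff)
    with assms show False by (simp add: summable_real_powr_iff)
  qed
  then have "UNIV \<notin> power_ideal a"
    by (simp add: power_ideal_def summable_on_UNIV_nonneg_real_iff power_weight_nonneg)
  moreover have sub: "B \<in> power_ideal a" if "A \<in> power_ideal a" "B \<subseteq> A" for A B
    using that unfolding power_ideal_def by (blast intro: summable_on_subset_banach)
  moreover have "A \<union> B \<in> power_ideal a" if "A \<in> power_ideal a" "B \<in> power_ideal a" for A B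
  proof -
    \<comment> \<open>Summability is additive over disjoint unions, so \<open>B\<close> is first cut
      down to \<open>B - A\<close>.\<close>
    have "B - A \<in> power_ideal a" using that(2) by (rule sub) blast
    with that have "power_weight a summable_on (A \<union> (B - A))"
      by (intro summable_on_Un_disjoint) (auto simp: power_ideal_def)
    then show ?thesis by (simp add: power_ideal_def)
  qed
  moreover have "finite A \<Longrightarrow> A \<in> power_ideal a" for A
    by (simp add: power_ideal_def)
  ultimately show ?thesis
    unfolding ideal_on_omega_def by blast
qed

section \<open>Counting along injections and recovery of the exponent\<close>

text \<open>Comparability of the weights bounds \<open>\<phi> i\<close> for all \<open>i < n\<close>
  outside a set \<open>S\<close> of the ideal. As \<open>S\<close> has only \<open>o(n)\<close>
  elements below \<open>n\<close>, eventually at least half of the indices below \<open>n\<close>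
  remain, and injectivity turns them into distinct elements of the range.\<close>

lemma injection_counting_bound:
  fixes \<phi> :: "nat \<Rightarrow> nat"
  assumes a: "0 < a" "a < 1" and b: "0 < b" and inj: "inj \<phi>"
    and incl: "\<And>S. power_weight b summable_on \<phi> ` S \<Longrightarrow> power_weight a summable_on S"
  obtains K where "K > 0"
    "\<forall>\<^sub>F n in sequentially.
       real n / 2 \<le> card {m \<in> range \<phi>. real (m + 1) \<le> K * real n powr (a / b)}"
proof -
  obtain C where C: "C > 0"
    and Csum: "power_weight a summable_on {n. power_weight a n > C * power_weight b (\<phi> n)}"
  proof (rule summable_inclusion_imp_comparable[of "power_weight a" "\<lambda>n. power_weight b (\<phi> n)"])
    show "power_weight a summable_on S" if "(\<lambda>n. power_weight b (\<phi> n)) summable_on S" for S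
      using that inj by (intro incl) (simp add: summable_on_reindex inj_on_subset o_def)
  qed (use a in \<open>auto intro: power_weight_nonneg power_weight_le_1\<close>)
  define S where "S = {n. power_weight a n > C * power_weight b (\<phi> n)}"
  define M where "M = infsum (power_weight a) S"
  \<comment> \<open>This constant comes from solving
    \<open>(\<phi> i + 1) powr b \<le> C * n powr a\<close> for \<open>\<phi> i + 1\<close>.\<close>
  define K where "K = C powr (1 / b)"
  have "K > 0" using C by (simp add: K_def)
  \<comment> \<open>Each index below \<open>n\<close> has weight at least \<open>n powr - a\<close>,
    while all of \<open>S\<close> has total weight \<open>M\<close>.\<close>
  have cardS: "card (S \<inter> {..<n}) \<le> M * real n powr a" if "n > 0" for n
  proof -
    have "card (S \<inter> {..<n}) * real n powr - a = (\<Sum>i\<in>S \<inter> {..<n}. real n powr - a)" by simp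
    also have "\<dots> \<le> sum (power_weight a) (S \<inter> {..<n})"
      using a by (intro sum_mono) (auto simp: power_weight_def intro!: powr_mono2')
    also have "\<dots> \<le> M"
      unfolding M_def using Csum by (intro finite_sum_le_infsum) (auto simp: S_def power_weight_nonneg)
    finally show ?thesis using that by (simp add: powr_minus field_simps)
  qed
  have img: "real (\<phi> i + 1) \<le> K * real n powr (a / b)" if "i < n" "i \<notin> S" for i n
  proof -
    have "real n powr - a \<le> power_weight a i"
      using that a by (auto simp: power_weight_def intro!: powr_mono2')
    also have "\<dots> \<le> C * real (\<phi> i + 1) powr - b"
      using that by (simp add: S_def power_weight_def)
    finally have "real (\<phi> i + 1) powr b \<le> C * real n powr a"
      using that by (simp add: powr_minus field_simps)
    then have "(real (\<phi> i + 1) powr b) powr (1 / b) \<le> (C * real n powr a) powr (1 / b)"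
      using b by (intro powr_mono2) auto
    then show ?thesis using b C by (simp add: powr_powr powr_mult K_def)
  qed
  \<comment> \<open>Here \<open>a < 1\<close> enters: the bound \<open>M * n powr a\<close> is
    eventually below \<open>n / 2\<close>.\<close>
  have "((\<lambda>n. M * real n powr (a - 1)) \<longlongrightarrow> M * 0) sequentially"
    using a by (intro tendsto_mult tendsto_const tendsto_neg_powr filterlim_real_sequentially) auto
  then have "\<forall>\<^sub>F n in sequentially. M * real n powr (a - 1) < 1 / 2"
    by (rule order_tendstoD) simp
  then have "\<forall>\<^sub>F n in sequentially.
       real n / 2 \<le> card {m \<in> range \<phi>. real (m + 1) \<le> K * real n powr (a / b)}"
    using eventually_gt_at_top[of 0]
  proof eventually_elim
    case (elim n)
    let ?T = "{m \<in> range \<phi>. real (m + 1) \<le> K * real n powr (a / b)}"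
    have "?T \<subseteq> {..nat \<lceil>K * real n powr (a / b)\<rceil>}"
      by (auto simp: le_nat_iff) linarith
    then have "finite ?T" by (rule finite_subset) simp
    then have "card ({..<n} - S) \<le> card ?T"
      using inj img by (intro card_inj_on_le[of \<phi>]) (auto intro: inj_on_subset)
    moreover have "card ({..<n} - S) = n - card (S \<inter> {..<n})"
      by (simp add: card_Diff_subset_Int Int_commute)
    ultimately have "real n - card (S \<inter> {..<n}) \<le> card ?T" by linarith
    moreover have "M * real n powr a = n * (M * real n powr (a - 1))"
      using elim by (simp add: powr_diff)
    then have "M * real n powr a \<le> n * (1 / 2)"
      using elim by (metis less_eq_real_def mult_left_mono of_nat_0_le_iff)
    ultimately show ?case using cardS[of n] elim by linarith
  qed
  with \<open>K > 0\<close> that show ?thesis by blast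
qed

text \<open>Now \<open>a / b < 1\<close>, so about \<open>n / 2\<close> distinct naturals would have
  to fit below \<open>K * n powr (a / b)\<close>, which is \<open>o(n)\<close>.\<close>

lemma no_inclusion_into_smaller_exponent:
  fixes \<phi> :: "nat \<Rightarrow> nat"
  assumes a: "0 < a" "a < b" "b < 1" and inj: "inj \<phi>"
    and incl: "\<And>S. power_weight b summable_on \<phi> ` S \<Longrightarrow> power_weight a summable_on S"
  shows False
proof -
  obtain K where K: "K > 0" and ev: "\<forall>\<^sub>F n in sequentially.
       real n / 2 \<le> card {m \<in> range \<phi>. real (m + 1) \<le> K * real n powr (a / b)}"
    by (rule injection_counting_bound[OF _ _ _ inj incl]) (use a in auto)
  have "((\<lambda>n. K * real n powr (a / b - 1)) \<longlongrightarrow> K * 0) sequentially"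
    using a by (intro tendsto_mult tendsto_const tendsto_neg_powr filterlim_real_sequentially) auto
  then have "\<forall>\<^sub>F n in sequentially. K * real n powr (a / b - 1) < 1 / 2"
    by (rule order_tendstoD) simp
  then have "\<forall>\<^sub>F n::nat in sequentially. False"
    using ev eventually_gt_at_top[of 0]
  proof eventually_elim
    case (elim n)
    let ?x = "K * real n powr (a / b)"
    have "{m \<in> range \<phi>. real (m + 1) \<le> ?x} \<subseteq> {..<nat \<lfloor>?x\<rfloor>}"
      by (auto simp: zless_nat_eq_int_zless) linarith
    then have "card {m \<in> range \<phi>. real (m + 1) \<le> ?x} \<le> nat \<lfloor>?x\<rfloor>"
      by (metis card_lessThan card_mono finite_lessThan)
    moreover have "real (nat \<lfloor>?x\<rfloor>) \<le> ?x" using K by simp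
    ultimately have "real n / 2 \<le> ?x" using elim by linarith
    moreover have "?x = n * (K * real n powr (a / b - 1))"
      using elim by (simp add: powr_diff)
    moreover have "n * (K * real n powr (a / b - 1)) < n * (1 / 2)"
      using elim by (intro mult_strict_left_mono) auto
    ultimately show False by simp
  qed
  then show False by simp
qed

lemma ideal_isomorphic_refl: "ideal_isomorphic \<I> \<I>"
  unfolding ideal_isomorphic_def by (rule exI[of _ id]) auto

text \<open>An isomorphism yields inclusions in both directions, one along \<open>\<phi>\<close> and
  one along its inverse. The first is impossible for \<open>b < a\<close>, the second for
  \<open>a < b\<close>.\<close>

lemma not_ideal_isomorphic_power_ideal:
  assumes a: "0 < a" "a < 1" and b: "0 < b" "b < 1" and "a \<noteq> b"
  shows "\<not> ideal_isomorphic (power_ideal a) (power_ideal b)"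
proof
  assume "ideal_isomorphic (power_ideal a) (power_ideal b)"
  then obtain \<phi> :: "nat \<Rightarrow> nat" where \<phi>: "bij \<phi>"
    and iso: "\<And>A. A \<in> power_ideal a \<longleftrightarrow> \<phi> -` A \<in> power_ideal b"
    unfolding ideal_isomorphic_def by blast
  have 1: "power_weight b summable_on S" if "power_weight a summable_on \<phi> ` S" for S
    using iso[of "\<phi> ` S"] that \<phi> by (simp add: power_ideal_def inj_vimage_image_eq bij_is_inj)
  have 2: "power_weight a summable_on S" if "power_weight b summable_on inv \<phi> ` S" for S
    using iso[of S] that \<phi> by (simp add: power_ideal_def bij_vimage_eq_inv_image)
  show False
    using \<open>a \<noteq> b\<close> a b \<phi> 1 2
      no_inclusion_into_smaller_exponent[of b a \<phi>] no_inclusion_into_smaller_exponent[of a b "inv \<phi>"]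
    by (meson bij_imp_bij_inv bij_is_inj linorder_neqE)
qed

section \<open>Increasing enumerations of sets of positive lower density\<close>

text \<open>Indices start at 0: if the element of index \<open>j\<close> exceeded \<open>x\<close>,
  all members up to \<open>x\<close> would be among the first \<open>j\<close>.\<close>

lemma enumerate_le_if_card_gt:
  assumes A: "infinite (A :: nat set)" and X: "j < card (A \<inter> {..x})"
  shows "enumerate A j \<le> x"
proof (rule ccontr)
  assume "\<not> enumerate A j \<le> x"
  have "A \<inter> {..x} \<subseteq> enumerate A ` {..<j}"
  proof
    fix m assume m: "m \<in> A \<inter> {..x}"
    then obtain i where i: "enumerate A i = m" using enumerate_Ex[OF A] by blast
    have "i < j"
      using m i \<open>\<not> enumerate A j \<le> x\<close> A
        by (metis IntD2 atMost_iff enumerate_mono_le_iff le_trans not_le)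
    with i show "m \<in> enumerate A ` {..<j}" by blast
  qed
  then have "card (A \<inter> {..x}) \<le> card (enumerate A ` {..<j})" by (intro card_mono) auto
  also have "\<dots> \<le> j" using card_image_le[of "{..<j}" "enumerate A"] by simp
  finally show False using X by simp
qed

text \<open>Taking \<open>n = 2 * (j + 1)\<close> in the density hypothesis gives
  \<open>j + 1\<close> members of \<open>A\<close> below a multiple of \<open>j + 1\<close>, hence
  bounds the element of index \<open>j\<close>.\<close>

lemma enumerate_linear_bound:
  assumes A: "infinite (A :: nat set)" and K: "K > 0"
    and ev: "\<forall>\<^sub>F n in sequentially. real n / 2 \<le> card {m \<in> A. real (m + 1) \<le> K * real n}"
  obtains L where "L > 0" "\<And>j. real (enumerate A j + 1) \<le> L * real (j + 1)"
proof -
  obtain N where N: "\<And>n. n \<ge> N \<Longrightarrow> real n / 2 \<le> card {m \<in> A. real (m + 1) \<le> K * real n}"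
    using ev by (auto simp: eventually_sequentially)
  have large: "real (enumerate A j + 1) \<le> 2 * K * real (j + 1)" if "j \<ge> N" for j
  proof -
    define y where "y = K * real (2 * (j + 1))"
    define T where "T = {m \<in> A. real (m + 1) \<le> y}"
    have sub: "T \<subseteq> A \<inter> {..nat \<lfloor>y\<rfloor> - 1}"
      by (auto simp: T_def le_nat_iff le_floor_iff le_diff_conv2)
    have "real (2 * (j + 1)) / 2 \<le> card T"
      unfolding y_def T_def using that by (intro N) simp
    then have le: "j < card T" by simp
    then have "T \<noteq> {}" by force
    \<comment> \<open>This makes the truncated subtraction in
      \<open>nat \<lfloor>y\<rfloor> - 1\<close> exact.\<close>
    then have "y \<ge> 1" by (force simp: T_def)
    have "card T \<le> card (A \<inter> {..nat \<lfloor>y\<rfloor> - 1})"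
      using sub by (intro card_mono) auto
    with le have "j < card (A \<inter> {..nat \<lfloor>y\<rfloor> - 1})" by simp
    then have "enumerate A j \<le> nat \<lfloor>y\<rfloor> - 1" by (rule enumerate_le_if_card_gt[OF A])
    then have "real (enumerate A j + 1) \<le> y" using \<open>y \<ge> 1\<close> by linarith
    then show ?thesis by (simp add: y_def mult_ac)
  qed
  \<comment> \<open>The first summand serves the indices from \<open>N\<close> on; the second covers
    the finitely many earlier ones by monotonicity.\<close>
  define L where "L = 2 * K + real (enumerate A N + 1)"
  have "real (enumerate A j + 1) \<le> L * real (j + 1)" for j
  proof (cases "j \<ge> N")
    case True
    have "2 * K * real (j + 1) \<le> L * real (j + 1)" by (intro mult_right_mono) (auto simp: L_def)
    with large[OF True] show ?thesis by linarith
  next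
    case False
    then have "enumerate A j \<le> enumerate A N" using A by simp
    then have "real (enumerate A j + 1) \<le> L" using K by (simp add: L_def)
    also have "\<dots> \<le> L * real (j + 1)" using K by (simp add: L_def)
    finally show ?thesis .
  qed
  moreover have "L > 0" using K by (simp add: L_def)
  ultimately show ?thesis using that by blast
qed

lemma mem_ideal_restrict_iff:
  assumes "ideal_on_omega \<I>" "B \<subseteq> A"
  shows "B \<in> ideal_restrict \<I> A \<longleftrightarrow> B \<in> \<I>"
  using assms unfolding ideal_on_omega_def ideal_restrict_def by blast

text \<open>The given isomorphism serves only to show that \<open>A\<close> has positive lower
  density. Then the index \<open>j\<close> and the element \<open>enumerate A j\<close> have weights
  within a constant factor of each other, so summability passes both ways.\<close>

lemma enumerate_witnesses_power_ideal:
  assumes a: "0 < a" "a < 1" and iso: "restrict_isomorphic (power_ideal a) A"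
  shows "witnesses_restrict_iso (power_ideal a) A (enumerate A)"
proof -
  note [simp] = mem_ideal_restrict_iff[OF ideal_on_omega_power_ideal[OF a]]
  obtain \<phi> where \<phi>: "bij_betw \<phi> UNIV A"
    and w: "\<And>B. B \<subseteq> A \<Longrightarrow> B \<in> power_ideal a \<longleftrightarrow> \<phi> -` B \<in> power_ideal a"
    using iso unfolding restrict_isomorphic_def witnesses_restrict_iso_def by auto
  have inj: "inj \<phi>" and ran: "range \<phi> = A" using \<phi> by (auto simp: bij_betw_def)
  have A: "infinite A" using \<phi> bij_betw_finite infinite_UNIV_nat by blast
  have incl: "power_weight a summable_on S" if "power_weight a summable_on \<phi> ` S" for S
    using w[of "\<phi> ` S"] that inj ran by (auto simp: power_ideal_def inj_vimage_image_eq)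
  \<comment> \<open>With equal exponents \<open>a / b\<close> becomes 1, and the counting bound is
    linear in \<open>n\<close>.\<close>
  obtain K where K: "K > 0" and ev: "\<forall>\<^sub>F n in sequentially.
       real n / 2 \<le> card {m \<in> A. real (m + 1) \<le> K * real n}"
    by (rule injection_counting_bound[OF a a(1) inj incl]) (use a ran in auto)
  obtain L where L: "L > 0" "\<And>j. real (enumerate A j + 1) \<le> L * real (j + 1)"
    by (rule enumerate_linear_bound[OF A K ev]) auto
  let ?e = "enumerate A"
  have up: "power_weight a (?e j) \<le> power_weight a j" for j
    using a A by (intro power_weight_antimono le_enumerate) auto
  have low: "power_weight a j \<le> L powr a * power_weight a (?e j)" for j
  proof -
    have "(L * real (j + 1)) powr - a \<le> power_weight a (?e j)"
      unfolding power_weight_def using a L(2)[of j] by (intro powr_mono2') auto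
    then have "L powr - a * power_weight a j \<le> power_weight a (?e j)"
      using L(1) by (simp add: powr_mult power_weight_def)
    then show ?thesis using L(1) by (simp add: powr_minus field_simps)
  qed
  have bij: "bij_betw ?e UNIV A" using A by (rule bij_enumerate)
  have "B \<in> power_ideal a \<longleftrightarrow> ?e -` B \<in> power_ideal a" if B: "B \<subseteq> A" for B
  proof -
    have "bij_betw ?e (?e -` B) B"
      using bij B by (auto simp: bij_betw_def inj_on_def image_vimage_eq)
    then have "power_weight a summable_on B \<longleftrightarrow> (\<lambda>j. power_weight a (?e j)) summable_on (?e -` B)"
      by (rule summable_on_reindex_bij_betw[symmetric])
    also have "\<dots> \<longleftrightarrow> power_weight a summable_on (?e -` B)"
    proof
      assume "(\<lambda>j. power_weight a (?e j)) summable_on (?e -` B)"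
      then have "(\<lambda>j. L powr a * power_weight a (?e j)) summable_on (?e -` B)"
        by (rule summable_on_cmult_right)
      then show "power_weight a summable_on (?e -` B)"
        by (rule summable_on_comparison_test) (use low power_weight_nonneg in auto)
    next
      assume "power_weight a summable_on (?e -` B)"
      then show "(\<lambda>j. power_weight a (?e j)) summable_on (?e -` B)"
        by (rule summable_on_comparison_test) (use up power_weight_nonneg in auto)
    qed
    finally show ?thesis by (simp add: power_ideal_def)
  qed
  with bij show ?thesis by (simp add: witnesses_restrict_iso_def)
qed

theorem corollary3:
  "\<exists>\<F> :: nat set set set.
     \<F> \<approx> (UNIV :: real set) \<and>
     pairwise (\<lambda>\<I> \<J>. \<not> ideal_isomorphic \<I> \<J>) \<F> \<and>
     (\<forall>\<I>\<in>\<F>. ideal_on_omega \<I> \<and>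
        (\<forall>A. A \<notin> \<I> \<longrightarrow> restrict_isomorphic \<I> A \<longrightarrow>
           witnesses_restrict_iso \<I> A (enumerate A)))"
proof (intro exI conjI)
  let ?F = "power_ideal ` {0<..<1}"
  \<comment> \<open>Equal ideals are isomorphic, so nonisomorphism for distinct exponents already
    gives injectivity and hence the cardinality of the family.\<close>
  have "inj_on power_ideal {0<..<1}"
    by (rule inj_onI) (metis greaterThanLessThan_iff ideal_isomorphic_refl
        not_ideal_isomorphic_power_ideal)
  then have "?F \<approx> {0<..<1::real}"
    by (rule inj_on_image_eqpoll_self)
  also have "{0<..<1::real} \<approx> (UNIV :: real set)"
    using open_interval_eqpoll_reals[of 0 1] by simp
  finally show "?F \<approx> (UNIV :: real set)" .
  show "pairwise (\<lambda>\<I> \<J>. \<not> ideal_isomorphic \<I> \<J>) ?F"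
    using not_ideal_isomorphic_power_ideal by (force simp: pairwise_def)
  show "\<forall>\<I>\<in>?F. ideal_on_omega \<I> \<and>
        (\<forall>A. A \<notin> \<I> \<longrightarrow> restrict_isomorphic \<I> A \<longrightarrow>
           witnesses_restrict_iso \<I> A (enumerate A))"
    using ideal_on_omega_power_ideal enumerate_witnesses_power_ideal by auto
qed

end
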